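(* Let $n\ge p\ge 1$ be integers, let $B\in\mathbb{R}^{n\times n}$ be symmetric, and let $G\in\mathbb{R}^{p\times p}$ and $A\in\mathbb{R}^{n\times n}$ be symmetric positive definite. There is no Lagrangian duality gap of (GTRP) or (GR), where these problems and their Lagrangian duals are as defined in the context, if and only if any unit eigenvectors corresponding to $\lambda_{\max}(I_p\otimes(A^{-1}B))$, denoted by $\mathrm{vec}(\hat X)$ with $\hat X\in\mathbb{R}^{n\times p}$, satisfy $\hat X^T\hat X=\frac1p I_p$.
   Context: $I_k$ is the $k\times k$ identity matrix, $\otimes$ is the Kronecker product, and $\mathrm{vec}(X)$ is the vector obtained by stacking the columns of $X$. For symmetric matrices, $P\preceq R$ means that $R-P$ is positive semidefinite, and $W\succeq 0$ means that $W$ is positive semidefinite. $\lambda_{\max}$ denotes the largest eigenvalue, and a unit eigenvector corresponding to $\lambda_{\max}(I_p\otimes(A^{-1}B))$ is an eigenvector of $I_p\otimes(A^{-1}B)$ of Euclidean norm 1 for that eigenvalue. Problem (GTRP): $\max\ \frac{\mathrm{tr}(GX^TBX)}{\mathrm{tr}(GX^TAX)}$ over $X\in\mathbb{R}^{n\times p}$ subject to $X^TX=I_p$. Its Lagrangian dual is $$\inf_{M}\ \sup_{X\in\mathbb{R}^{n\times p},\,X\ne0}\ \frac{\mathrm{tr}(GX^TBX)}{\mathrm{tr}(GX^TAX)}+\mathrm{tr}\big(M(X^TX-I_p)\big),$$ with infimum over symmetric $M\in\mathbb{R}^{p\times p}$. Problem (GR): $\max\ \frac{\mathrm{tr}(GX^TBX)}{\mathrm{tr}(GX^TAX)}$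 over $X\in\mathbb{R}^{n\times p}$ subject to $X^TX=I_p$ and $XX^T\preceq I_n$. Its Lagrangian dual is $$\inf_{M,\,W\succeq0}\ \sup_{X\in\mathbb{R}^{n\times p},\,X\ne0}\ \frac{\mathrm{tr}(GX^TBX)}{\mathrm{tr}(GX^TAX)}+\mathrm{tr}\big(M(X^TX-I_p)\big)+\mathrm{tr}\big(W(I_n-XX^T)\big),$$ with infimum over symmetric $M\in\mathbb{R}^{p\times p}$ and symmetric positive semidefinite $W\in\mathbb{R}^{n\times n}$. "No Lagrangian duality gap" means that the optimal value of the problem equals the optimal value of its Lagrangian dual.
   Formalization: "Any unit eigenvectors satisfy" is taken as "some unit eigenvector satisfies"; read as "every", the claim fails for p ≥ 2, e.g. A = B = I_n, G = I_p (no gap, but the unit eigenvector vec(e_1 e_1^T) violates the condition). The equivalence is proved for (GTRP) and (GR) separately. *)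

theory Defs
  imports "HOL-Analysis.Analysis"
begin

text \<open>
  A real matrix with \<open>n\<close> rows and \<open>p\<close> columns is an element of \<open>real^'p^'n\<close>, where
  \<open>n = CARD('n)\<close> and \<open>p = CARD('p)\<close>, so that \<open>n \<ge> 1\<close> and \<open>p \<ge> 1\<close> are automatic.
\<close>

definition symmetric_mat :: "real^'n^'n \<Rightarrow> bool" where
  "symmetric_mat P \<longleftrightarrow> transpose P = P"

definition pos_def :: "real^'n^'n \<Rightarrow> bool" where
  "pos_def P \<longleftrightarrow> symmetric_mat P \<and> (\<forall>x. x \<noteq> 0 \<longrightarrow> 0 < x \<bullet> (P *v x))"

definition pos_semidef :: "real^'n^'n \<Rightarrow> bool" where
  "pos_semidef P \<longleftrightarrow> symmetric_mat P \<and> (\<forall>x. 0 \<le> x \<bullet> (P *v x))"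

definition loewner_le :: "real^'n^'n \<Rightarrow> real^'n^'n \<Rightarrow> bool"  (infix "\<preceq>\<^sub>L" 50) where
  "P \<preceq>\<^sub>L R \<longleftrightarrow> pos_semidef (R - P)"

text \<open>
  A vector of length \<open>p n\<close> made of \<open>p\<close> consecutive blocks of length \<open>n\<close> is indexed by
  \<open>'p \<times> 'n\<close>: the index \<open>(j, i)\<close> is position \<open>i\<close> of block \<open>j\<close>.  Hence stacking the
  columns of \<open>X\<close> puts the entry in row \<open>i\<close>, column \<open>j\<close> at index \<open>(j, i)\<close>, and block
  \<open>(j, l)\<close> of the Kronecker product of \<open>P\<close> and \<open>Q\<close> is \<open>P $ j $ l\<close> times \<open>Q\<close>.
\<close>

definition vec_cols :: "real^'p^'n \<Rightarrow> real^('p \<times> 'n)" where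
  "vec_cols X = (\<chi> k. X $ snd k $ fst k)"

definition kronecker :: "real^'p^'p \<Rightarrow> real^'n^'n \<Rightarrow> real^('p \<times> 'n)^('p \<times> 'n)"
    (infixl "\<otimes>\<^sub>K" 70) where
  "P \<otimes>\<^sub>K Q = (\<chi> r c. P $ fst r $ fst c * Q $ snd r $ snd c)"

lemma kronecker_mat_1_vec_cols:
  fixes Q :: "real^'n^'n" and X :: "real^'p^'n"
  shows "(mat 1 \<otimes>\<^sub>K Q) *v vec_cols X = vec_cols (Q ** X)"
proof -
  have "(\<Sum>k\<in>UNIV. (if j = fst k then 1 else 0) * Q $ i $ snd k * X $ snd k $ fst k)
      = (\<Sum>m\<in>UNIV. Q $ i $ m * X $ m $ j)" for i j
  proof -
    have "(\<Sum>k\<in>UNIV. (if j = fst k then 1 else 0) * Q $ i $ snd k * X $ snd k $ fst k)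
        = (\<Sum>l\<in>UNIV. \<Sum>m\<in>UNIV. (if j = l then 1 else 0) * Q $ i $ m * X $ m $ l)"
      by (simp add: UNIV_Times_UNIV [symmetric] sum.cartesian_product' del: UNIV_Times_UNIV)
    also have "\<dots> = (\<Sum>l\<in>UNIV. if j = l then \<Sum>m\<in>UNIV. Q $ i $ m * X $ m $ l else 0)"
      by (intro sum.cong) auto
    finally show ?thesis
      by simp
  qed
  then show ?thesis
    by (simp add: vec_eq_iff kronecker_def vec_cols_def matrix_vector_mult_def
        matrix_matrix_mult_def mat_def)
qed

definition eigenvector :: "real^'k^'k \<Rightarrow> real \<Rightarrow> real^'k \<Rightarrow> bool" where
  "eigenvector K l v \<longleftrightarrow> v \<noteq> 0 \<and> K *v v = l *\<^sub>R v"

definition lambda_max :: "real^'k^'k \<Rightarrow> real" where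
  "lambda_max K = (GREATEST l. \<exists>v. eigenvector K l v)"

definition trace_ratio ::
    "real^'n^'n \<Rightarrow> real^'n^'n \<Rightarrow> real^'p^'p \<Rightarrow> real^'p^'n \<Rightarrow> real" where
  "trace_ratio A B G X =
     trace (G ** transpose X ** B ** X) / trace (G ** transpose X ** A ** X)"

text \<open>Optimal values are extended reals, since the inner suprema of the duals may be infinite.\<close>

definition GTRP_value :: "real^'n^'n \<Rightarrow> real^'n^'n \<Rightarrow> real^'p^'p \<Rightarrow> ereal" where
  "GTRP_value A B G =
     (SUP X \<in> {X :: real^'p^'n. transpose X ** X = mat 1}. ereal (trace_ratio A B G X))"

definition GTRP_dual_value :: "real^'n^'n \<Rightarrow> real^'n^'n \<Rightarrow> real^'p^'p \<Rightarrow> ereal" where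
  "GTRP_dual_value A B G =
     (INF M \<in> {M :: real^'p^'p. symmetric_mat M}.
        SUP X \<in> {X :: real^'p^'n. X \<noteq> 0}.
          ereal (trace_ratio A B G X + trace (M ** (transpose X ** X - mat 1))))"

definition GR_value :: "real^'n^'n \<Rightarrow> real^'n^'n \<Rightarrow> real^'p^'p \<Rightarrow> ereal" where
  "GR_value A B G =
     (SUP X \<in> {X :: real^'p^'n. transpose X ** X = mat 1 \<and> X ** transpose X \<preceq>\<^sub>L mat 1}.
        ereal (trace_ratio A B G X))"

definition GR_dual_value :: "real^'n^'n \<Rightarrow> real^'n^'n \<Rightarrow> real^'p^'p \<Rightarrow> ereal" where
  "GR_dual_value A B G =
     (INF (M, W) \<in> {M :: real^'p^'p. symmetric_mat M} \<times> {W :: real^'n^'n. pos_semidef W}.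
        SUP X \<in> {X :: real^'p^'n. X \<noteq> 0}.
          ereal (trace_ratio A B G X + trace (M ** (transpose X ** X - mat 1))
            + trace (W ** (mat 1 - X ** transpose X))))"

end

theory Submission
  imports Defs
begin

text \<open>
  Let \<open>\<mu>\<close> be the maximum of \<open>x \<bullet> (B *v x) / (x \<bullet> (A *v x))\<close>, which is also the largest
  eigenvalue of \<open>mat 1 \<otimes>\<^sub>K (matrix_inv A ** B)\<close>, so that \<open>\<mu> *\<^sub>R A - B\<close> is positive semidefinite.
  Writing \<open>G\<close> as a sum of rank-one matrices shows that the trace ratio is at most \<open>\<mu>\<close>, with
  equality iff \<open>B ** X = \<mu> *\<^sub>R (A ** X)\<close>.  The ratio is invariant under scaling of \<open>X\<close>, so scaling
  \<open>X\<close> in the Lagrangian shows that both duals have the value \<open>\<mu>\<close>, attained at zero multipliers.  By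
  compactness the primal maximum is attained, so there is no gap iff some \<open>X\<close> with
  orthonormal columns satisfies \<open>B ** X = \<mu> *\<^sub>R (A ** X)\<close>; the constraint \<open>X ** transpose X \<preceq>\<^sub>L mat 1\<close> of
  (GR) is redundant.
\<close>

section \<open>Semidefinite quadratic forms and their kernels\<close>

lemma pos_def_imp_pos_semidef: "pos_def P \<Longrightarrow> pos_semidef P"
  unfolding pos_def_def pos_semidef_def
  by (metis inner_zero_left less_eq_real_def)

lemma symmetric_mat_inner:
  assumes "symmetric_mat P"
  shows "x \<bullet> (P *v y) = (P *v x) \<bullet> y"
  by (metis assms dot_lmul_matrix matrix_transpose_mul symmetric_mat_def transpose_matrix_vector)

lemma inner_transpose_matrix_vector:
  fixes X :: "real^'p^'n"
  shows "x \<bullet> (transpose X *v y) = (X *v x) \<bullet> y"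
  by (metis dot_lmul_matrix inner_commute transpose_matrix_vector)

lemma form_transpose_mult:
  fixes X :: "real^'p^'n"
  shows "v \<bullet> ((transpose X ** C ** X) *v v) = (X *v v) \<bullet> (C *v (X *v v))"
  by (simp add: matrix_vector_mul_assoc [symmetric] inner_transpose_matrix_vector
      del: transpose_matrix_vector)

text \<open>The form at \<open>x + t *\<^sub>R y\<close> is a quadratic in \<open>t\<close> that
  never becomes negative, so its discriminant is at most 0. As \<open>P\<close> may be singular, the
  leading coefficient \<open>a\<close> can vanish and that case is separate.\<close>

lemma pos_semidef_cauchy_schwarz:
  assumes "pos_semidef P"
  shows "(x \<bullet> (P *v y))\<^sup>2 \<le> (x \<bullet> (P *v x)) * (y \<bullet> (P *v y))"
proof -
  define a b c where "a = y \<bullet> (P *v y)" and "b = x \<bullet> (P *v y)" and "c = x \<bullet> (P *v x)"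
  have sym: "y \<bullet> (P *v x) = b"
    using assms symmetric_mat_inner [of P y x] by (simp add: b_def pos_semidef_def inner_commute)
  have form: "0 \<le> c + 2 * t * b + t\<^sup>2 * a" for t
  proof -
    have "0 \<le> (x + t *\<^sub>R y) \<bullet> (P *v (x + t *\<^sub>R y))"
      using assms by (simp add: pos_semidef_def)
    also have "\<dots> = c + 2 * t * b + t\<^sup>2 * a"
      using sym by (simp add: a_def b_def c_def matrix_vector_right_distrib matrix_vector_mult_scaleR
          inner_add_left inner_add_right algebra_simps power2_eq_square)
    finally show ?thesis .
  qed
  have a0: "0 \<le> a" and c0: "0 \<le> c" using assms by (auto simp: a_def c_def pos_semidef_def)
  show ?thesis
  proof (cases "a = 0")
    case True
    have "b = 0"
    proof (rule ccontr)
      assume "b \<noteq> 0"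
      \<comment> \<open>With \<open>a = 0\<close> the quadratic is linear in \<open>t\<close>, and
        this \<open>t\<close> gives it the value -1.\<close>
      then show False using form [of "- (c + 1) / (2 * b)"] True c0 by (simp add: field_simps)
    qed
    then show ?thesis using True by (simp add: a_def b_def c_def)
  next
    case False
    \<comment> \<open>The minimizer of the quadratic is \<open>t = - b / a\<close>.\<close>
    have "0 \<le> c - b\<^sup>2 / a"
      using form [of "- b / a"] False by (simp add: field_simps power2_eq_square)
    then show ?thesis using False a0 by (simp add: a_def b_def c_def field_simps)
  qed
qed

text \<open>Cauchy-Schwarz for the pair \<open>P *v x\<close>, \<open>x\<close> bounds the fourth
  power of the norm of \<open>P *v x\<close> by 0.\<close>

lemma pos_semidef_form_eq_0:
  assumes "pos_semidef P" "x \<bullet> (P *v x) = 0"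
  shows "P *v x = 0"
  using pos_semidef_cauchy_schwarz [OF assms(1), of "P *v x" x] assms(2) by simp

section \<open>Decomposition into rank-one matrices\<close>

definition outer :: "real^'n \<Rightarrow> real^'n^'n" where
  "outer v = (\<chi> i j. v $ i * v $ j)"

lemma outer_mult_vec: "outer v *v y = (v \<bullet> y) *\<^sub>R v"
  by (simp add: outer_def matrix_vector_mult_def vec_eq_iff inner_vec_def sum_distrib_left
      mult_ac)

lemma symmetric_mat_outer: "symmetric_mat (outer v)"
  by (simp add: symmetric_mat_def outer_def transpose_def mult.commute)

lemma trace_outer_mult: "trace (outer v ** Q) = v \<bullet> (Q *v v)"
proof -
  have "trace (outer v ** Q) = (\<Sum>i\<in>UNIV. \<Sum>k\<in>UNIV. v $ i * v $ k * Q $ k $ i)"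
    by (simp add: trace_def outer_def matrix_matrix_mult_def)
  also have "\<dots> = (\<Sum>k\<in>UNIV. \<Sum>i\<in>UNIV. v $ i * v $ k * Q $ k $ i)"
    by (rule sum.swap)
  also have "\<dots> = v \<bullet> (Q *v v)"
    by (simp add: inner_vec_def matrix_vector_mult_def sum_distrib_left mult_ac)
  finally show ?thesis .
qed

text \<open>Subtracting the rank-one matrix built from \<open>P *v x\<close> keeps \<open>P\<close> positive semidefinite by
  Cauchy-Schwarz and adds \<open>x\<close> to its kernel.\<close>

lemma pos_semidef_sum_outer:
  fixes P :: "real^'n^'n"
  assumes "pos_semidef P"
  shows "\<exists>vs. P = sum_list (map outer vs)"
  using assms
\<comment> \<open>The measure is the rank of \<open>P\<close>.\<close>
proof (induction "CARD('n) - dim {x. P *v x = 0}" arbitrary: P rule: less_induct)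
  case (less P)
  show ?case
  proof (cases "P = 0")
    case True
    then have "P = sum_list (map outer [])" by simp
    then show ?thesis by blast
  next
    case False
    then obtain x where x: "P *v x \<noteq> 0"
      by (metis matrix_eq matrix_vector_mult_0)
    define a where "a = x \<bullet> (P *v x)"
    \<comment> \<open>The factor \<open>1 / sqrt a\<close> makes \<open>outer v *v x\<close> equal
      to \<open>P *v x\<close>, so the subtraction kills \<open>x\<close>.\<close>
    define v where "v = (1 / sqrt a) *\<^sub>R (P *v x)"
    define P' where "P' = P - outer v"
    have a: "a > 0"
      using less.prems pos_semidef_form_eq_0 [OF less.prems, of x] x
      by (auto simp: a_def pos_semidef_def less_le)
    have inner_v: "y \<bullet> v = (y \<bullet> (P *v x)) / sqrt a" for y
      by (simp add: v_def)
    have P'_mult: "P' *v y = P *v y - (v \<bullet> y) *\<^sub>R v" for y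
      by (simp add: P'_def matrix_vector_mult_diff_rdistrib outer_mult_vec)
    have psd: "pos_semidef P'"
      unfolding pos_semidef_def
    proof (intro conjI allI)
      show "symmetric_mat P'"
        using less.prems symmetric_mat_outer [of v]
        by (auto simp: P'_def pos_semidef_def symmetric_mat_def transpose_def vec_eq_iff)
      fix y
      have "(y \<bullet> v)\<^sup>2 = (y \<bullet> (P *v x))\<^sup>2 / a"
        using a by (simp add: inner_v power_divide)
      also have "\<dots> \<le> y \<bullet> (P *v y)"
        using pos_semidef_cauchy_schwarz [OF less.prems, of y x] a by (simp add: a_def field_simps)
      finally show "0 \<le> y \<bullet> (P' *v y)"
        by (simp add: P'_mult inner_diff_right inner_commute power2_eq_square)
    qed
    have "P' *v x = 0"
    proof -
      have "(v \<bullet> x) *\<^sub>R v = (a / (sqrt a * sqrt a)) *\<^sub>R (P *v x)"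
        using a by (simp add: inner_commute [of v] inner_v a_def [symmetric]) (simp add: v_def)
      then show ?thesis using a by (simp add: P'_mult)
    qed
    moreover have "P' *v y = 0" if "P *v y = 0" for y
    proof -
      have "y \<bullet> (P *v x) = 0"
        using symmetric_mat_inner [of P y x] less.prems that by (simp add: pos_semidef_def)
      then show ?thesis using that by (simp add: P'_mult inner_commute [of v] inner_v)
    qed
    ultimately have sub: "{y. P *v y = 0} \<subset> {y. P' *v y = 0}" using x by blast
    have subspace: "subspace {y. Q *v y = 0}" for Q :: "real^'n^'n"
      by (simp add: subspace_def matrix_vector_right_distrib matrix_vector_mult_scaleR)
    have "dim {y. P *v y = 0} < dim {y. P' *v y = 0}"
      using subspace_dim_equal [OF subspace subspace, of P P'] sub by force
    moreover have "dim {y. P' *v y = 0} \<le> CARD('n)"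
      using dim_subset_UNIV [of "{y. P' *v y = 0}"] by simp
    ultimately obtain vs where "P' = sum_list (map outer vs)"
      using less.hyps [OF _ psd] by force
    then have "P = sum_list (map outer (v # vs))" by (simp add: P'_def algebra_simps)
    then show ?thesis by blast
  qed
qed

section \<open>Positivity of trace forms\<close>

lemma trace_zero: "trace (0 :: real^'n^'n) = 0"
  by (simp add: trace_def)

lemma matrix_add_rdistrib: "(P + P') ** Q = P ** Q + P' ** (Q :: real^'m^'n)"
  for P P' :: "real^'n^'k"
  by (simp add: vec_eq_iff matrix_matrix_mult_def sum.distrib distrib_right)

lemma trace_sum_outer_mult:
  "trace (sum_list (map outer vs) ** Q) = (\<Sum>v\<leftarrow>vs. v \<bullet> (Q *v v))"
  by (induction vs) (simp_all add: matrix_add_rdistrib trace_add trace_outer_mult trace_zero)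

text \<open>\<open>P ** Q\<close> is in general not symmetric, but writing \<open>P\<close> as a sum
  of rank-one matrices turns the trace into a sum of values of the form of \<open>Q\<close>.\<close>

lemma trace_mult_pos_semidef:
  assumes "pos_semidef P" "pos_semidef Q"
  shows "0 \<le> trace (P ** Q)"
proof -
  obtain vs where "P = sum_list (map outer vs)"
    using pos_semidef_sum_outer [OF assms(1)] by blast
  then show ?thesis
    using assms(2) by (auto simp: trace_sum_outer_mult pos_semidef_def intro!: sum_list_nonneg)
qed

lemma pos_semidef_transpose_mult:
  fixes X :: "real^'p^'n"
  assumes "pos_semidef C"
  shows "pos_semidef (transpose X ** C ** X)"
  using assms unfolding pos_semidef_def form_transpose_mult
  by (simp add: symmetric_mat_def matrix_transpose_mul matrix_mul_assoc)

lemma pos_def_invertible: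
  assumes "pos_def P"
  shows "invertible P"
proof -
  have "x = 0" if "P *v x = 0" for x
    using assms that by (metis inner_zero_right less_irrefl pos_def_def)
  then show ?thesis
    by (metis invertible_left_inverse matrix_left_invertible_ker)
qed

lemma matrix_inv_cancel:
  fixes P :: "real^'n^'n"
  assumes "invertible P"
  shows matrix_inv_right: "P ** matrix_inv P = mat 1"
    and matrix_inv_left: "matrix_inv P ** P = mat 1"
  using someI_ex [OF assms [unfolded invertible_def]] by (simp_all add: matrix_inv_def)

text \<open>The trace is a sum of nonnegative terms, one for each rank-one summand of
  \<open>G\<close>. If it vanishes, \<open>C ** X\<close> kills every vector of the decomposition,
  hence the range of \<open>G\<close>, which is the whole space.\<close>

lemma trace_form_eq_0:
  fixes X :: "real^'p^'n"
  assumes G: "pos_def G" and C: "pos_semidef C"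
    and 0: "trace (G ** (transpose X ** C ** X)) = 0"
  shows "C ** X = 0"
proof -
  obtain vs where vs: "G = sum_list (map outer vs)"
    using pos_semidef_sum_outer G pos_def_imp_pos_semidef by blast
  have "(X *v v) \<bullet> (C *v (X *v v)) = 0" if "v \<in> set vs" for v
  proof -
    have "(\<Sum>v\<leftarrow>vs. (X *v v) \<bullet> (C *v (X *v v))) = 0"
      using 0 by (simp add: vs trace_sum_outer_mult form_transpose_mult)
    then show ?thesis
      using C that by (subst (asm) sum_list_nonneg_eq_0_iff) (auto simp: pos_semidef_def)
  qed
  then have ker: "(C ** X) *v v = 0" if "v \<in> set vs" for v
    using that pos_semidef_form_eq_0 [OF C] by (simp add: matrix_vector_mul_assoc [symmetric])
  have "(C ** X) *v (G *v y) = 0" for y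
    unfolding vs using ker
    by (induction vs)
      (auto simp: matrix_vector_mult_add_rdistrib matrix_vector_right_distrib outer_mult_vec
        matrix_vector_mult_scaleR)
  then have "(C ** X) *v z = 0" for z
    using pos_def_invertible [OF G]
    by (metis matrix_inv_right matrix_vector_mul_assoc matrix_vector_mul_lid)
  then show ?thesis
    by (simp add: matrix_eq)
qed

text \<open>This keeps the denominator of the trace ratio positive: in the zero case
  \<open>A ** X = 0\<close>, and \<open>A\<close> is invertible.\<close>

lemma trace_form_pos:
  fixes X :: "real^'p^'n"
  assumes G: "pos_def G" and A: "pos_def A" and X: "X \<noteq> 0"
  shows "0 < trace (G ** (transpose X ** A ** X))"
proof -
  have "0 \<le> trace (G ** (transpose X ** A ** X))"
    using G A by (simp add: trace_mult_pos_semidef pos_semidef_transpose_mult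
        pos_def_imp_pos_semidef)
  moreover have "trace (G ** (transpose X ** A ** X)) \<noteq> 0"
  proof
    assume "trace (G ** (transpose X ** A ** X)) = 0"
    then have "A ** X = 0"
      using trace_form_eq_0 [OF G pos_def_imp_pos_semidef [OF A]] by blast
    then have "matrix_inv A ** (A ** X) = 0"
      by simp
    then show False
      using X matrix_inv_left [OF pos_def_invertible [OF A]] by (simp add: matrix_mul_assoc)
  qed
  ultimately show ?thesis by simp
qed

section \<open>The largest generalized eigenvalue\<close>

text \<open>The quotient is scale invariant, so its maximum over the compact unit sphere is global.
  At a maximizer the semidefinite form of \<open>\<mu> *\<^sub>R A - B\<close> vanishes, which puts
  the maximizer in the kernel.\<close>

lemma exists_max_generalized_eigenvalue:
  fixes A B :: "real^'n^'n"
  assumes A: "pos_def A" and B: "symmetric_mat B"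
  obtains \<mu> x where "pos_semidef (\<mu> *\<^sub>R A - B)" "x \<noteq> 0" "B *v x = \<mu> *\<^sub>R (A *v x)"
proof -
  define r where "r x = (x \<bullet> (B *v x)) / (x \<bullet> (A *v x))" for x
  have A_pos: "0 < x \<bullet> (A *v x)" if "x \<noteq> 0" for x
    using A that by (simp add: pos_def_def)
  have "continuous_on (sphere 0 1) r"
    unfolding r_def using A_pos
    by (intro continuous_intros matrix_vector_mult_linear_continuous_on)
      (metis less_irrefl mem_sphere_0 norm_zero zero_neq_one)
  moreover have "sphere 0 1 \<noteq> ({} :: (real^'n) set)"
    by simp
  ultimately obtain x0 where x0: "x0 \<in> sphere 0 1" "\<And>x. x \<in> sphere 0 1 \<Longrightarrow> r x \<le> r x0"
    using continuous_attains_sup [of "sphere 0 1" r] by auto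
  define C where "C = r x0 *\<^sub>R A - B"
  have C_mult: "C *v x = r x0 *\<^sub>R (A *v x) - B *v x" for x
    by (simp add: C_def matrix_vector_mult_diff_rdistrib scaleR_matrix_vector_assoc)
  have le: "r x \<le> r x0" if "x \<noteq> 0" for x
  proof -
    have "r x = r ((1 / norm x) *\<^sub>R x)"
      using that by (simp add: r_def matrix_vector_mult_scaleR)
    then show ?thesis using x0(2) [of "(1 / norm x) *\<^sub>R x"] that by simp
  qed
  have psd: "pos_semidef C"
    unfolding pos_semidef_def
  proof (intro conjI allI)
    show "symmetric_mat C"
      using A B by (auto simp: C_def pos_def_def symmetric_mat_def transpose_def vec_eq_iff)
    fix x
    show "0 \<le> x \<bullet> (C *v x)"
      using le [of x] A_pos [of x]
      by (cases "x = 0") (auto simp: C_mult inner_diff_right r_def [of x] field_simps)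
  qed
  have x0_nz: "x0 \<noteq> 0" using x0(1) by auto
  then have "x0 \<bullet> (C *v x0) = 0"
    using A_pos [OF x0_nz] by (simp add: C_mult inner_diff_right r_def)
  then have "C *v x0 = 0"
    using pos_semidef_form_eq_0 [OF psd] by blast
  then have "B *v x0 = r x0 *\<^sub>R (A *v x0)"
    by (simp add: C_mult)
  then show ?thesis
    using that psd x0_nz unfolding C_def by blast
qed

section \<open>Comparison of the trace ratio with \<mu>\<close>

lemmas matrix_mult_scaleR = scalar_matrix_assoc [symmetric] matrix_scalar_ac

lemma matrix_diff_left: "(P - P') ** Q = P ** Q - P' ** (Q :: real^'m^'n)"
  for P P' :: "real^'n^'k"
  by (simp add: vec_eq_iff matrix_matrix_mult_def sum_subtractf left_diff_distrib)

lemma matrix_diff_right: "P ** (Q - Q') = P ** Q - P ** (Q' :: real^'m^'n)"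
  for P :: "real^'n^'k"
  by (simp add: vec_eq_iff matrix_matrix_mult_def sum_subtractf right_diff_distrib)

lemma trace_scaleR: "trace (c *\<^sub>R P) = c * trace (P :: real^'n^'n)"
  by (simp add: trace_def sum_distrib_left)

text \<open>When the trace form of \<open>A\<close> is positive, dividing by it gives \<mu> minus
  the trace ratio; the sign and the vanishing of this trace thus decide the bound and its equality
  case.\<close>

lemma trace_form_pencil:
  fixes X :: "real^'p^'n"
  shows "trace (G ** (transpose X ** (\<mu> *\<^sub>R A - B) ** X))
    = \<mu> * trace (G ** (transpose X ** A ** X)) - trace (G ** (transpose X ** B ** X))"
  by (simp add: matrix_diff_left matrix_diff_right matrix_mult_scaleR
      trace_sub trace_scaleR)

lemma trace_ratio_le:
  fixes X :: "real^'p^'n"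
  assumes "pos_def G" "pos_def A" "pos_semidef (\<mu> *\<^sub>R A - B)" "X \<noteq> 0"
  shows "trace_ratio A B G X \<le> \<mu>"
proof -
  have "0 \<le> trace (G ** (transpose X ** (\<mu> *\<^sub>R A - B) ** X))"
    using assms by (simp add: trace_mult_pos_semidef pos_semidef_transpose_mult
        pos_def_imp_pos_semidef)
  then show ?thesis
    using trace_form_pos [OF assms(1,2,4)]
    unfolding trace_form_pencil by (simp add: trace_ratio_def matrix_mul_assoc field_simps)
qed

lemma trace_ratio_eq_iff:
  fixes X :: "real^'p^'n"
  assumes "pos_def G" "pos_def A" "pos_semidef (\<mu> *\<^sub>R A - B)" "X \<noteq> 0"
  shows "trace_ratio A B G X = \<mu> \<longleftrightarrow> B ** X = \<mu> *\<^sub>R (A ** X)"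
proof -
  have "trace_ratio A B G X = \<mu> \<longleftrightarrow> trace (G ** (transpose X ** (\<mu> *\<^sub>R A - B) ** X)) = 0"
    using trace_form_pos [OF assms(1,2,4)]
    unfolding trace_form_pencil by (auto simp: trace_ratio_def matrix_mul_assoc field_simps)
  also have "\<dots> \<longleftrightarrow> (\<mu> *\<^sub>R A - B) ** X = 0"
    using trace_form_eq_0 [OF assms(1,3), of X]
    by (auto simp: matrix_mul_assoc [symmetric] trace_zero)
  also have "\<dots> \<longleftrightarrow> B ** X = \<mu> *\<^sub>R (A ** X)"
    by (auto simp: matrix_diff_left matrix_mult_scaleR)
  finally show ?thesis .
qed

section \<open>The feasible set and attainment of the primal maximum\<close>

lemma exists_orthonormal_columns:
  assumes "CARD('p::finite) \<le> CARD('n::finite)"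
  obtains V :: "real^'p^'n" where "transpose V ** V = mat 1"
proof -
  obtain f :: "'p \<Rightarrow> 'n" where f: "inj f"
    using assms card_le_inj [of "UNIV :: 'p set" "UNIV :: 'n set"] by auto
  \<comment> \<open>The columns are distinct standard basis vectors, selected by the injection
    \<open>f\<close>.\<close>
  define V :: "real^'p^'n" where "V = (\<chi> i j. if i = f j then 1 else 0)"
  have "(\<Sum>k\<in>UNIV. V $ k $ i * V $ k $ j) = (if i = j then 1 else 0)" for i j
  proof -
    have "(\<Sum>k\<in>UNIV. V $ k $ i * V $ k $ j)
      = (\<Sum>k\<in>UNIV. if k = f i then (if f i = f j then 1 else 0) else 0)"
      by (intro sum.cong) (auto simp: V_def)
    then show ?thesis using f by (simp add: inj_eq)
  qed
  then have "transpose V ** V = mat 1"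
    by (simp add: vec_eq_iff matrix_matrix_mult_def transpose_def mat_def)
  then show ?thesis by (rule that)
qed

lemma orthonormal_columns_nonzero:
  fixes V :: "real^'p^'n"
  assumes "transpose V ** V = mat 1"
  shows "V \<noteq> 0"
proof
  assume "V = 0"
  then have "(mat 1 :: real^'p^'p) = 0" using assms by simp
  then have "(mat 1 :: real^'p^'p) $ j $ j = 0" for j by simp
  then show False by (simp add: mat_def)
qed

text \<open>The difference \<open>Q\<close> is the orthogonal projection onto the complement of the
  column space: it is symmetric and idempotent, so it equals
  \<open>transpose Q ** mat 1 ** Q\<close>.\<close>

lemma orthonormal_columns_loewner:
  fixes V :: "real^'p^'n"
  assumes "transpose V ** V = mat 1"
  shows "V ** transpose V \<preceq>\<^sub>L mat 1"
proof -
  define Q where "Q = mat 1 - V ** transpose V"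
  have sym: "transpose Q = Q"
    by (simp add: Q_def transpose_def vec_eq_iff matrix_matrix_mult_def mat_def mult.commute)
  have "V ** transpose V ** (V ** transpose V) = V ** (transpose V ** V) ** transpose V"
    by (simp add: matrix_mul_assoc)
  then have "Q ** Q = Q"
    using assms by (simp add: Q_def matrix_diff_left matrix_diff_right)
  then have "Q = transpose Q ** mat 1 ** Q"
    by (simp add: sym)
  moreover have "pos_semidef (mat 1 :: real^'n^'n)"
    by (simp add: pos_semidef_def symmetric_mat_def transpose_mat)
  ultimately have "pos_semidef Q"
    using pos_semidef_transpose_mult by metis
  then show ?thesis by (simp add: loewner_le_def Q_def)
qed

text \<open>The columns are unit vectors, which bounds every entry by 1; the defining equations are
  continuous.\<close>

lemma compact_orthonormal_columns: "compact {X :: real^'p^'n. transpose X ** X = mat 1}"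
proof -
  have "\<bar>X $ i $ j\<bar> \<le> 1" if "transpose X ** X = mat 1" for X :: "real^'p^'n" and i j
  proof -
    have "(\<Sum>k\<in>UNIV. (X $ k $ j)\<^sup>2) = (transpose X ** X) $ j $ j"
      by (simp add: matrix_matrix_mult_def transpose_def power2_eq_square)
    also have "\<dots> = 1" using that by (simp add: mat_def)
    finally have "(X $ i $ j)\<^sup>2 \<le> 1"
      using member_le_sum [of i UNIV "\<lambda>k. (X $ k $ j)\<^sup>2"] by simp
    then show ?thesis by (simp add: abs_square_le_1)
  qed
  then have "norm X \<le> norm ((\<chi> i j. 1) :: real^'p^'n)"
    if "transpose X ** X = mat 1" for X :: "real^'p^'n"
    using that by (intro norm_le_componentwise_cart) simp
  then have "bounded {X :: real^'p^'n. transpose X ** X = mat 1}"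
    by (auto intro: boundedI)
  moreover have "closed {X :: real^'p^'n. transpose X ** X = mat 1}"
    unfolding matrix_matrix_mult_def transpose_def
    by (intro closed_Collect_eq continuous_intros)
  ultimately show ?thesis by (simp add: compact_eq_bounded_closed)
qed

lemma continuous_on_trace_form:
  "continuous_on S (\<lambda>X :: real^'p^'n. trace (G ** transpose X ** C ** X))"
  unfolding trace_def matrix_matrix_mult_def transpose_def
  by (simp, intro continuous_intros)

text \<open>Attainment turns an equality of optimal values into an actual feasible matrix whose
  ratio is that value.\<close>

lemma GTRP_value_attained:
  fixes A B :: "real^'n^'n" and G :: "real^'p^'p"
  assumes "CARD('p) \<le> CARD('n)" "pos_def G" "pos_def A"
  obtains V :: "real^'p^'n" where "transpose V ** V = mat 1"
    "GTRP_value A B G = ereal (trace_ratio A B G V)"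
proof -
  let ?S = "{X :: real^'p^'n. transpose X ** X = mat 1}"
  have "trace (G ** transpose X ** A ** X) \<noteq> 0" if "X \<in> ?S" for X
    using trace_form_pos [OF assms(2,3), of X] orthonormal_columns_nonzero [of X] that
    by (simp add: matrix_mul_assoc)
  then have "continuous_on ?S (trace_ratio A B G)"
    unfolding trace_ratio_def by (intro continuous_on_divide continuous_on_trace_form) auto
  moreover have "?S \<noteq> {}"
    using exists_orthonormal_columns [OF assms(1)] by blast
  ultimately obtain V
    where V: "V \<in> ?S" "\<And>X. X \<in> ?S \<Longrightarrow> trace_ratio A B G X \<le> trace_ratio A B G V"
    using continuous_attains_sup [OF compact_orthonormal_columns, of "trace_ratio A B G"] by blast
  then have "GTRP_value A B G = ereal (trace_ratio A B G V)"
    unfolding GTRP_value_def by (intro SUP_eqI) auto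
  then show ?thesis using V that by auto
qed

lemma GR_value_eq_GTRP_value: "GR_value A B G = GTRP_value A B G"
  unfolding GR_value_def GTRP_value_def
  using orthonormal_columns_loewner by (intro SUP_cong) auto

section \<open>Values of the Lagrangian duals\<close>

lemma trace_ratio_scaleR: "t \<noteq> 0 \<Longrightarrow> trace_ratio A B G (t *\<^sub>R X) = trace_ratio A B G X"
  by (simp add: trace_ratio_def transpose_scalar matrix_mult_scaleR trace_scaleR)

text \<open>Along the ray through \<open>X\<close> the Lagrangian is \<open>trace_ratio A B G X + t\<^sup>2 * q X + c\<close>.  Large \<open>t\<close>
  forces \<open>q V \<le> 0\<close> for a \<open>V\<close> with orthonormal columns, hence \<open>c \<ge> 0\<close>; then \<open>t\<close> near 0 gives the
  bound.\<close>

lemma trace_ratio_le_Lagrangian_SUP: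
  fixes A B W :: "real^'n^'n" and G M :: "real^'p^'p"
  assumes card: "CARD('p) \<le> CARD('n)" and W: "pos_semidef W" and X0: "X0 \<noteq> (0 :: real^'p^'n)"
  shows "ereal (trace_ratio A B G X0) \<le>
    (SUP X \<in> {X :: real^'p^'n. X \<noteq> 0}.
       ereal (trace_ratio A B G X + trace (M ** (transpose X ** X - mat 1))
         + trace (W ** (mat 1 - X ** transpose X))))" (is "_ \<le> ?S")
proof (rule ccontr)
  assume "\<not> ?thesis"
  then have "?S < ereal (trace_ratio A B G X0)"
    by (simp only: not_le)
  \<comment> \<open>A real \<open>s\<close> strictly between the two values replaces the extended
    real supremum by strict real inequalities.\<close>
  then obtain s where s: "?S < ereal s" "s < trace_ratio A B G X0"
    using ereal_dense2 [of ?S "ereal (trace_ratio A B G X0)"] by (auto simp only: less_ereal.simps)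
  define q where "q X = trace (M ** (transpose X ** X)) - trace (W ** (X ** transpose X))"
    for X :: "real^'p^'n"
  define c where "c = trace W - trace M"
  have bound: "trace_ratio A B G X + t\<^sup>2 * q X + c < s" if "X \<noteq> 0" "t \<noteq> 0" for X t
  proof -
    let ?F = "\<lambda>X. trace_ratio A B G X + trace (M ** (transpose X ** X - mat 1))
         + trace (W ** (mat 1 - X ** transpose X))"
    have "ereal (?F (t *\<^sub>R X)) \<le> ?S"
      using that by (intro SUP_upper) auto
    then have "ereal (?F (t *\<^sub>R X)) < ereal s"
      using s(1) by (rule le_less_trans)
    then have "?F (t *\<^sub>R X) < s"
      by (simp only: less_ereal.simps)
    then show ?thesis
      using that by (simp add: trace_ratio_scaleR q_def c_def matrix_diff_right trace_sub
          transpose_scalar matrix_mult_scaleR trace_scaleR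
          power2_eq_square algebra_simps)
  qed
  obtain V :: "real^'p^'n" where V: "transpose V ** V = mat 1"
    using exists_orthonormal_columns [OF card] by blast
  have "q V \<le> 0"
  proof (rule ccontr)
    assume "\<not> q V \<le> 0"
    then have q: "0 < q V" by simp
    \<comment> \<open>This \<open>t\<close> lifts the Lagrangian at \<open>t *\<^sub>R V\<close>
      above \<open>s\<close>.\<close>
    define t where "t = sqrt ((\<bar>s - c - trace_ratio A B G V\<bar> + 1) / q V)"
    have "t\<^sup>2 * q V = \<bar>s - c - trace_ratio A B G V\<bar> + 1"
      using q by (simp add: t_def)
    moreover have "t \<noteq> 0"
      using q by (simp add: t_def)
    ultimately show False
      using bound [OF orthonormal_columns_nonzero [OF V], of t] by linarith
  qed
  \<comment> \<open>Since \<open>transpose V ** V = mat 1\<close>, the terms in \<open>M\<close>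
    cancel and \<open>c + q V\<close> is the trace of
    \<open>W ** (mat 1 - V ** transpose V)\<close>.\<close>
  moreover have "0 \<le> c + q V"
    using trace_mult_pos_semidef [OF W orthonormal_columns_loewner [OF V, unfolded loewner_le_def]]
    by (simp add: c_def q_def V matrix_diff_right trace_sub)
  ultimately have c: "0 \<le> c" by simp
  define e where "e = trace_ratio A B G X0 + c - s"
  have e: "e > 0" using c s(2) by (simp add: e_def)
  \<comment> \<open>So small a \<open>t\<close> cannot let the quadratic term consume the surplus
    \<open>e\<close>; the added 1 keeps the divisor nonzero when \<open>q X0 = 0\<close>.\<close>
  define t where "t = sqrt (e / (\<bar>q X0\<bar> + 1))"
  have t2: "t\<^sup>2 = e / (\<bar>q X0\<bar> + 1)"
    using e by (simp add: t_def)
  have "t \<noteq> 0"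
    using e by (simp add: t_def)
  then have "e + t\<^sup>2 * q X0 < 0"
    using bound [OF X0] by (simp add: e_def algebra_simps)
  moreover have "- e \<le> t\<^sup>2 * q X0"
  proof -
    have "(- (\<bar>q X0\<bar> + 1)) * t\<^sup>2 \<le> q X0 * t\<^sup>2"
      by (intro mult_right_mono) auto
    moreover have "(- (\<bar>q X0\<bar> + 1)) * t\<^sup>2 = - e"
      unfolding mult_minus_left t2 by simp
    ultimately show ?thesis by (simp only: mult.commute)
  qed
  ultimately show False by simp
qed

text \<open>Zero multipliers give the upper bounds. The lower bounds come from any nonzero maximizer
  \<open>X0\<close> of the ratio, feasible or not, which is how a gap can arise.\<close>

lemma dual_values:
  fixes A B :: "real^'n^'n" and G :: "real^'p^'p"
  assumes card: "CARD('p) \<le> CARD('n)" and le: "\<And>X :: real^'p^'n. X \<noteq> 0 \<Longrightarrow> trace_ratio A B G X \<le> \<mu>"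
    and X0: "X0 \<noteq> (0 :: real^'p^'n)" "trace_ratio A B G X0 = \<mu>"
  shows "GTRP_dual_value A B G = ereal \<mu>" "GR_dual_value A B G = ereal \<mu>"
proof -
  have W0: "pos_semidef (0 :: real^'n^'n)" and M0: "symmetric_mat (0 :: real^'p^'p)"
    by (simp_all add: pos_semidef_def symmetric_mat_def transpose_def vec_eq_iff)
  show "GTRP_dual_value A B G = ereal \<mu>"
  proof (rule antisym)
    show "GTRP_dual_value A B G \<le> ereal \<mu>"
      unfolding GTRP_dual_value_def
      by (rule INF_lower2 [of 0]) (auto simp: M0 trace_zero le intro!: SUP_least)
    \<comment> \<open>The Lagrangian of (GTRP) is that of (GR) at \<open>W = 0\<close>.\<close>
    show "ereal \<mu> \<le> GTRP_dual_value A B G"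
      unfolding GTRP_dual_value_def
      using trace_ratio_le_Lagrangian_SUP [OF card W0 X0(1), of A B G]
      by (intro INF_greatest) (simp add: X0(2) trace_zero)
  qed
  show "GR_dual_value A B G = ereal \<mu>"
  proof (rule antisym)
    show "GR_dual_value A B G \<le> ereal \<mu>"
      unfolding GR_dual_value_def
      by (rule INF_lower2 [of "(0, 0)"]) (auto simp: M0 W0 trace_zero le intro!: SUP_least)
    show "ereal \<mu> \<le> GR_dual_value A B G"
      unfolding GR_dual_value_def
      using trace_ratio_le_Lagrangian_SUP [OF card _ X0(1), of _ A B G]
      by (intro INF_greatest) (auto simp: X0(2))
  qed
qed

section \<open>Vectorization and the Kronecker eigenproblem\<close>

lemma surj_vec_cols: "surj (vec_cols :: real^'p^'n \<Rightarrow> _)"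
proof (rule surjI)
  show "vec_cols (\<chi> i j. v $ (j, i)) = v" for v :: "real^('p \<times> 'n)"
    by (simp add: vec_cols_def vec_eq_iff)
qed

lemma vec_cols_eq_iff: "vec_cols X = vec_cols Y \<longleftrightarrow> X = Y"
  by (auto simp: vec_cols_def vec_eq_iff)

lemma vec_cols_0: "vec_cols 0 = 0"
  by (simp add: vec_cols_def vec_eq_iff)

lemma vec_cols_scaleR: "vec_cols (c *\<^sub>R X) = c *\<^sub>R vec_cols X"
  by (simp add: vec_cols_def vec_eq_iff)

lemma norm_vec_cols:
  fixes X :: "real^'p^'n"
  shows "(norm (vec_cols X))\<^sup>2 = trace (transpose X ** X)"
proof -
  have "(norm (vec_cols X))\<^sup>2 = (\<Sum>k\<in>UNIV. X $ snd k $ fst k * X $ snd k $ fst k)"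
    by (simp add: power2_norm_eq_inner inner_vec_def vec_cols_def)
  also have "\<dots> = (\<Sum>j\<in>UNIV. \<Sum>i\<in>UNIV. X $ i $ j * X $ i $ j)"
    by (simp add: UNIV_Times_UNIV [symmetric] sum.cartesian_product' del: UNIV_Times_UNIV)
  finally show ?thesis
    by (simp add: trace_def matrix_matrix_mult_def transpose_def)
qed

text \<open>The Kronecker product acts on \<open>vec_cols X\<close> as
  \<open>matrix_inv A ** B\<close> acts on \<open>X\<close>; multiplying by \<open>A\<close> or its
  inverse passes between the two equations.\<close>

lemma eigenvector_kronecker_iff:
  fixes A B :: "real^'n^'n" and X :: "real^'p^'n"
  assumes "invertible A"
  shows "eigenvector ((mat 1 :: real^'p^'p) \<otimes>\<^sub>K (matrix_inv A ** B)) l (vec_cols X)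
    \<longleftrightarrow> X \<noteq> 0 \<and> B ** X = l *\<^sub>R (A ** X)"
proof -
  have "matrix_inv A ** B ** X = l *\<^sub>R X \<longleftrightarrow> B ** X = l *\<^sub>R (A ** X)"
  proof
    assume "matrix_inv A ** B ** X = l *\<^sub>R X"
    then have "A ** (matrix_inv A ** B ** X) = l *\<^sub>R (A ** X)"
      by (simp add: matrix_mult_scaleR)
    then show "B ** X = l *\<^sub>R (A ** X)"
      by (simp add: matrix_mul_assoc matrix_inv_right [OF assms])
  next
    assume "B ** X = l *\<^sub>R (A ** X)"
    then have "matrix_inv A ** (B ** X) = l *\<^sub>R (matrix_inv A ** A ** X)"
      by (simp add: matrix_mult_scaleR matrix_mul_assoc)
    then show "matrix_inv A ** B ** X = l *\<^sub>R X"
      by (simp add: matrix_mul_assoc matrix_inv_left [OF assms])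
  qed
  then show ?thesis
    using vec_cols_eq_iff [of X 0]
    by (simp add: eigenvector_def kronecker_mat_1_vec_cols vec_cols_0 vec_cols_eq_iff
        flip: vec_cols_scaleR)
qed

text \<open>\<open>X0\<close> shows that \<mu> is an eigenvalue. Every eigenvector is some
  \<open>vec_cols X\<close>, and testing \<open>\<mu> *\<^sub>R A - B\<close> on a vector in the
  range of \<open>X\<close> shows that no eigenvalue exceeds \<mu>.\<close>

lemma lambda_max_kronecker:
  fixes A B :: "real^'n^'n" and X0 :: "real^'p^'n"
  assumes A: "pos_def A" and psd: "pos_semidef (\<mu> *\<^sub>R A - B)"
    and X0: "X0 \<noteq> 0" "B ** X0 = \<mu> *\<^sub>R (A ** X0)"
  shows "lambda_max ((mat 1 :: real^'p^'p) \<otimes>\<^sub>K (matrix_inv A ** B)) = \<mu>"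
  unfolding lambda_max_def
proof (rule Greatest_equality)
  note eig = eigenvector_kronecker_iff [OF pos_def_invertible [OF A], of B]
  show "\<exists>v. eigenvector ((mat 1 :: real^'p^'p) \<otimes>\<^sub>K (matrix_inv A ** B)) \<mu> v"
    using eig X0 by blast
  fix l
  assume "\<exists>v. eigenvector ((mat 1 :: real^'p^'p) \<otimes>\<^sub>K (matrix_inv A ** B)) l v"
  then obtain X :: "real^'p^'n" where X: "X \<noteq> 0" "B ** X = l *\<^sub>R (A ** X)"
    using eig by (metis surjD [OF surj_vec_cols])
  \<comment> \<open>\<open>X *v y\<close> is then a generalized eigenvector of the pair
    \<open>B\<close>, \<open>A\<close> for \<open>l\<close>.\<close>
  then obtain y where y: "X *v y \<noteq> 0"
    by (metis matrix_eq matrix_vector_mult_0)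
  have "B *v (X *v y) = l *\<^sub>R (A *v (X *v y))"
    using X by (simp add: matrix_vector_mul_assoc scaleR_matrix_vector_assoc)
  moreover have "0 \<le> (X *v y) \<bullet> ((\<mu> *\<^sub>R A - B) *v (X *v y))"
    using psd by (simp add: pos_semidef_def)
  ultimately have "0 \<le> (\<mu> - l) * ((X *v y) \<bullet> (A *v (X *v y)))"
    by (simp add: matrix_vector_mult_diff_rdistrib inner_diff_right algebra_simps
        flip: scaleR_matrix_vector_assoc)
  then show "l \<le> \<mu>"
    using A y by (simp add: pos_def_def zero_le_mult_iff) (metis less_le_not_le)
qed

section \<open>Zero gap as an eigenvector condition\<close>

text \<open>The eigenvector condition \<open>P\<close> is existential. If
  \<open>CARD('p) > 1\<close>, a matrix with equal columns, such as a normalized \<open>X0\<close>,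
  is always among the unit eigenvectors and has a Gram matrix of rank one, so a universal condition
  would always fail, although there is no gap for \<open>B = A\<close>.\<close>

theorem theorem6:
  fixes A B :: "real^'n^'n" and G :: "real^'p^'p"
  assumes "CARD('p) \<le> CARD('n)"
    and "symmetric_mat B"
    and "pos_def G"
    and "pos_def A"
  shows "let K = (mat 1 :: real^'p^'p) \<otimes>\<^sub>K (matrix_inv A ** B);
             P = (\<exists>X :: real^'p^'n.
                    eigenvector K (lambda_max K) (vec_cols X) \<and> norm (vec_cols X) = 1
                    \<and> transpose X ** X = (1 / real CARD('p)) *\<^sub>R mat 1)
         in (GTRP_value A B G = GTRP_dual_value A B G \<longleftrightarrow> P)
          \<and> (GR_value A B G = GR_dual_value A B G \<longleftrightarrow> P)"
proof -
  obtain \<mu> x where psd: "pos_semidef (\<mu> *\<^sub>R A - B)" and x: "x \<noteq> 0" "B *v x = \<mu> *\<^sub>R (A *v x)"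
    using exists_max_generalized_eigenvalue assms(2,4) by blast
  \<comment> \<open>Repeating \<open>x\<close> in every column gives a nonzero maximizer of the
    ratio, in general infeasible.\<close>
  define X0 :: "real^'p^'n" where "X0 = (\<chi> i j. x $ i)"
  have X0: "X0 \<noteq> 0" "B ** X0 = \<mu> *\<^sub>R (A ** X0)"
    using x by (auto simp: X0_def vec_eq_iff matrix_matrix_mult_def matrix_vector_mult_def)
  note ratio = trace_ratio_eq_iff [OF assms(3,4) psd]
  have dual: "GTRP_dual_value A B G = ereal \<mu>" "GR_dual_value A B G = ereal \<mu>"
    using dual_values [OF assms(1) trace_ratio_le [OF assms(3,4) psd] X0(1)] ratio [OF X0(1)] X0(2)
    by auto
  define K where "K = (mat 1 :: real^'p^'p) \<otimes>\<^sub>K (matrix_inv A ** B)"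
  have "eigenvector K (lambda_max K) (vec_cols X) \<longleftrightarrow> X \<noteq> 0 \<and> B ** X = \<mu> *\<^sub>R (A ** X)"
    for X :: "real^'p^'n"
    unfolding K_def lambda_max_kronecker [OF assms(4) psd X0]
    by (rule eigenvector_kronecker_iff [OF pos_def_invertible [OF assms(4)]])
  note eig = this
  define P where "P = (\<exists>X :: real^'p^'n.
    eigenvector K (lambda_max K) (vec_cols X) \<and> norm (vec_cols X) = 1
    \<and> transpose X ** X = (1 / real CARD('p)) *\<^sub>R mat 1)"
  obtain V :: "real^'p^'n" where V: "transpose V ** V = mat 1"
    "GTRP_value A B G = ereal (trace_ratio A B G V)"
    using GTRP_value_attained [OF assms(1,3,4)] by blast
  have "GTRP_value A B G = ereal \<mu> \<longleftrightarrow> P"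
  proof
    assume "GTRP_value A B G = ereal \<mu>"
    then have V_eq: "B ** V = \<mu> *\<^sub>R (A ** V)"
      using V ratio [OF orthonormal_columns_nonzero] by simp
    \<comment> \<open>The \<open>CARD('p)\<close> unit columns of \<open>V\<close> give
      \<open>vec_cols V\<close> the norm \<open>sqrt (real CARD('p))\<close>, hence this
      normalization; \<open>Y\<close> below undoes it.\<close>
    define X where "X = (1 / sqrt (real CARD('p))) *\<^sub>R V"
    have tX: "transpose X ** X = (1 / real CARD('p)) *\<^sub>R mat 1"
      by (simp add: X_def transpose_scalar matrix_mult_scaleR V)
    have "X \<noteq> 0" using orthonormal_columns_nonzero [OF V(1)] by (simp add: X_def)
    moreover have "B ** X = \<mu> *\<^sub>R (A ** X)"
      by (simp add: X_def matrix_mult_scaleR V_eq)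
    moreover have "norm (vec_cols X) = 1"
      using norm_vec_cols [of X] by (simp add: tX trace_scaleR trace_I power2_eq_1_iff)
        (metis norm_ge_zero not_one_le_zero neg_0_le_iff_le)
    ultimately show P
      using tX eig unfolding P_def by blast
  next
    assume P
    then obtain X :: "real^'p^'n" where X: "B ** X = \<mu> *\<^sub>R (A ** X)"
      "transpose X ** X = (1 / real CARD('p)) *\<^sub>R mat 1"
      using eig unfolding P_def by blast
    define Y where "Y = sqrt (real CARD('p)) *\<^sub>R X"
    have Y: "transpose Y ** Y = mat 1"
      by (simp add: Y_def transpose_scalar matrix_mult_scaleR X)
    have "B ** Y = \<mu> *\<^sub>R (A ** Y)"
      by (simp add: Y_def matrix_mult_scaleR X)
    then have "trace_ratio A B G Y = \<mu>"
      using ratio [OF orthonormal_columns_nonzero [OF Y]] by simp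
    then have "ereal \<mu> \<le> GTRP_value A B G"
      unfolding GTRP_value_def using Y by (intro SUP_upper2 [of Y]) auto
    then show "GTRP_value A B G = ereal \<mu>"
      using V trace_ratio_le [OF assms(3,4) psd orthonormal_columns_nonzero [OF V(1)]] by simp
  qed
  then show ?thesis
    unfolding Let_def K_def [symmetric] P_def [symmetric] dual GR_value_eq_GTRP_value by simp
qed

end
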